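(* Let $S$ be a regular AG-band and let $A=(\mu_A,\gamma_A)$ be an intuitionistic fuzzy set of $S$. If $A$ is an intuitionistic fuzzy $(1,2)$-ideal of $S$, then $A$ is an intuitionistic fuzzy left ideal of $S$.
   Context: An AG-groupoid is a non-empty set $S$ with a binary operation satisfying the left invertive law $(ab)c=(cb)a$ for all $a,b,c\in S$ (no associativity is assumed). $S$ is an AG-band if $aa=a$ for all $a\in S$. $S$ is regular if for every $a\in S$ there is $x\in S$ with $a=(ax)a$. An intuitionistic fuzzy set (IFS) of $S$ is a pair $A=(\mu_A,\gamma_A)$ of functions $\mu_A,\gamma_A:S\to[0,1]$ with $0\le \mu_A(x)+\gamma_A(x)\le 1$ for all $x\in S$. An IFS $A$ is an intuitionistic fuzzy left ideal if $\mu_A(xy)\ge\mu_A(y)$ and $\gamma_A(xy)\le\gamma_A(y)$ for all $x,y\in S$. It is an intuitionistic fuzzy AG-subgroupoid if $\mu_A(xy)\ge\min\{\mu_A(x),\mu_A(y)\}$ and $\gamma_A(xy)\le\max\{\gamma_A(x),\gamma_A(y)\}$ for all $x,y\in S$. An intuitionistic fuzzy $(1,2)$-ideal is an intuitionistic fuzzy AG-subgroupoid with $\mu_A((xw)(yz))\ge\min\{\mu_A(x),\mu_A(y),\mu_A(z)\}$ and $\gamma_A((xw)(yz))\le\max\{\gamma_A(x),\gamma_A(y),\gamma_A(z)\}$ for all $x,w,y,z\in S$. *)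

theory Defs
  imports Complex_Main
begin

text \<open>
  An AG-groupoid is carried by a whole type \<open>'a\<close>, so its carrier is automatically non-empty.
\<close>

locale ag_groupoid =
  fixes mult :: "'a \<Rightarrow> 'a \<Rightarrow> 'a"  (infixl \<open>\<cdot>\<close> 70)
  assumes left_invertive: "(a \<cdot> b) \<cdot> c = (c \<cdot> b) \<cdot> a"

locale ag_band = ag_groupoid +
  assumes idem: "a \<cdot> a = a"

locale regular_ag_groupoid = ag_groupoid +
  assumes regular: "\<exists>x. a = (a \<cdot> x) \<cdot> a"

text \<open>
  A pair \<open>A = (\<mu>, \<gamma>)\<close> of membership and non-membership functions.
\<close>

type_synonym 'a fuzzy_pair = "('a \<Rightarrow> real) \<times> ('a \<Rightarrow> real)"

abbreviation membership :: "'a fuzzy_pair \<Rightarrow> 'a \<Rightarrow> real" (\<open>\<mu>\<^bsub>_\<^esub>\<close>)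
  where "\<mu>\<^bsub>A\<^esub> \<equiv> fst A"

abbreviation nonmembership :: "'a fuzzy_pair \<Rightarrow> 'a \<Rightarrow> real" (\<open>\<gamma>\<^bsub>_\<^esub>\<close>)
  where "\<gamma>\<^bsub>A\<^esub> \<equiv> snd A"

definition intuitionistic_fuzzy_set :: "'a fuzzy_pair \<Rightarrow> bool" where
  "intuitionistic_fuzzy_set A \<longleftrightarrow>
     (\<forall>x. \<mu>\<^bsub>A\<^esub> x \<in> {0..1} \<and> \<gamma>\<^bsub>A\<^esub> x \<in> {0..1} \<and>
          0 \<le> \<mu>\<^bsub>A\<^esub> x + \<gamma>\<^bsub>A\<^esub> x \<and> \<mu>\<^bsub>A\<^esub> x + \<gamma>\<^bsub>A\<^esub> x \<le> 1)"

definition if_left_ideal :: "('a \<Rightarrow> 'a \<Rightarrow> 'a) \<Rightarrow> 'a fuzzy_pair \<Rightarrow> bool" where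
  "if_left_ideal f A \<longleftrightarrow> intuitionistic_fuzzy_set A \<and>
     (\<forall>x y. \<mu>\<^bsub>A\<^esub> (f x y) \<ge> \<mu>\<^bsub>A\<^esub> y \<and> \<gamma>\<^bsub>A\<^esub> (f x y) \<le> \<gamma>\<^bsub>A\<^esub> y)"

definition if_ag_subgroupoid :: "('a \<Rightarrow> 'a \<Rightarrow> 'a) \<Rightarrow> 'a fuzzy_pair \<Rightarrow> bool" where
  "if_ag_subgroupoid f A \<longleftrightarrow> intuitionistic_fuzzy_set A \<and>
     (\<forall>x y. \<mu>\<^bsub>A\<^esub> (f x y) \<ge> min (\<mu>\<^bsub>A\<^esub> x) (\<mu>\<^bsub>A\<^esub> y) \<and>
            \<gamma>\<^bsub>A\<^esub> (f x y) \<le> max (\<gamma>\<^bsub>A\<^esub> x) (\<gamma>\<^bsub>A\<^esub> y))"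

definition if_12_ideal :: "('a \<Rightarrow> 'a \<Rightarrow> 'a) \<Rightarrow> 'a fuzzy_pair \<Rightarrow> bool" where
  "if_12_ideal f A \<longleftrightarrow> if_ag_subgroupoid f A \<and>
     (\<forall>x w y z.
        \<mu>\<^bsub>A\<^esub> (f (f x w) (f y z)) \<ge> Min {\<mu>\<^bsub>A\<^esub> x, \<mu>\<^bsub>A\<^esub> y, \<mu>\<^bsub>A\<^esub> z} \<and>
        \<gamma>\<^bsub>A\<^esub> (f (f x w) (f y z)) \<le> Max {\<gamma>\<^bsub>A\<^esub> x, \<gamma>\<^bsub>A\<^esub> y, \<gamma>\<^bsub>A\<^esub> z})"

end

theory Submission imports Defs begin

text \<open>
  The identity \<open>y \<cdot> x = (a \<cdot> x) \<cdot> (a \<cdot> y)\<close> with \<open>a = (y \<cdot> x) \<cdot> y\<close> holds in every AG-band. Hence a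
  subset \<open>I\<close> with \<open>(I \<cdot> S) \<cdot> (I \<cdot> I) \<subseteq> I\<close> satisfies \<open>I \<cdot> S \<subseteq> I\<close>, and \<open>x \<cdot> y = (y \<cdot> x) \<cdot> x\<close> then gives
  \<open>S \<cdot> I \<subseteq> I\<close>. The fuzzy statement follows by taking for \<open>I\<close> the upper level sets of \<open>\<mu>\<close> and
  the lower level sets of \<open>\<gamma>\<close>.
\<close>

text \<open>Three uses of the left invertive law:
  \<open>(ab)(cd) = ((cd)b)a = ((bd)c)a = (ac)(bd)\<close>.\<close>

lemma (in ag_groupoid) medial: "(a \<cdot> b) \<cdot> (c \<cdot> d) = (a \<cdot> c) \<cdot> (b \<cdot> d)"
  by (metis left_invertive)

context ag_band
begin

lemma mult_mult_right_same: "(a \<cdot> b) \<cdot> b = b \<cdot> a"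
  by (metis left_invertive idem)

lemma mult_eq_12_product: "y \<cdot> x = (((y \<cdot> x) \<cdot> y) \<cdot> x) \<cdot> (((y \<cdot> x) \<cdot> y) \<cdot> y)"
proof -
  \<comment> \<open>\<open>(yx)(yy) = (yy)(xy)\<close>.\<close>
  have "(y \<cdot> x) \<cdot> y = y \<cdot> (x \<cdot> y)"
    by (metis medial idem)
  \<comment> \<open>\<open>medial\<close> brings the two copies of \<open>(yx)y\<close> together,
    and \<open>idem\<close> merges them.\<close>
  then have "(((y \<cdot> x) \<cdot> y) \<cdot> x) \<cdot> (((y \<cdot> x) \<cdot> y) \<cdot> y) = (y \<cdot> (x \<cdot> y)) \<cdot> (x \<cdot> y)"
    by (metis medial idem)
  \<comment> \<open>\<open>(y(xy))(xy) = (xy)y = yx\<close>.\<close>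
  then show ?thesis
    by (simp add: mult_mult_right_same)
qed

lemma left_ideal_if_12_ideal:
  assumes I: "\<And>x w y z. x \<in> I \<Longrightarrow> y \<in> I \<Longrightarrow> z \<in> I \<Longrightarrow> (x \<cdot> w) \<cdot> (y \<cdot> z) \<in> I"
    and "y \<in> I"
  shows "x \<cdot> y \<in> I"
proof -
  have right: "u \<cdot> w \<in> I" if "u \<in> I" for u w
  proof -
    \<comment> \<open>This is \<open>(uw)(uu)\<close>.\<close>
    have "(u \<cdot> w) \<cdot> u \<in> I"
      using I[of u u u w] that by (simp add: idem)
    then show ?thesis
      using I that mult_eq_12_product by metis
  qed
  then have "(y \<cdot> x) \<cdot> x \<in> I"
    using \<open>y \<in> I\<close> by blast
  then show ?thesis
    by (simp add: mult_mult_right_same)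
qed

end

theorem theorem7:
  fixes f :: "'a \<Rightarrow> 'a \<Rightarrow> 'a" and A :: "'a fuzzy_pair"
  assumes "ag_band f" and "regular_ag_groupoid f"
    and "intuitionistic_fuzzy_set A"
    and "if_12_ideal f A"
  shows "if_left_ideal f A"
proof -
  interpret ag_band f by fact
  have \<mu>: "Min {\<mu>\<^bsub>A\<^esub> x, \<mu>\<^bsub>A\<^esub> y, \<mu>\<^bsub>A\<^esub> z} \<le> \<mu>\<^bsub>A\<^esub> (f (f x w) (f y z))"
    and \<gamma>: "\<gamma>\<^bsub>A\<^esub> (f (f x w) (f y z)) \<le> Max {\<gamma>\<^bsub>A\<^esub> x, \<gamma>\<^bsub>A\<^esub> y, \<gamma>\<^bsub>A\<^esub> z}" for x w y z
    using \<open>if_12_ideal f A\<close> unfolding if_12_ideal_def by blast+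
  have "\<mu>\<^bsub>A\<^esub> y \<le> \<mu>\<^bsub>A\<^esub> (f x y)" for x y
  proof -
    \<comment> \<open>The level is the value at \<open>y\<close>, so \<open>y\<close> lies in the
      set.\<close>
    have "f x y \<in> {u. \<mu>\<^bsub>A\<^esub> y \<le> \<mu>\<^bsub>A\<^esub> u}"
      by (rule left_ideal_if_12_ideal) (auto intro: order_trans[OF _ \<mu>])
    then show ?thesis by simp
  qed
  moreover have "\<gamma>\<^bsub>A\<^esub> (f x y) \<le> \<gamma>\<^bsub>A\<^esub> y" for x y
  proof -
    have "f x y \<in> {u. \<gamma>\<^bsub>A\<^esub> u \<le> \<gamma>\<^bsub>A\<^esub> y}"
      by (rule left_ideal_if_12_ideal) (auto intro: order_trans[OF \<gamma>])
    then show ?thesis by simp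
  qed
  ultimately show ?thesis
    using \<open>intuitionistic_fuzzy_set A\<close> unfolding if_left_ideal_def by blast
qed

end
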